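(* There exist functions $c_1,c_2:\mathbb{C}\setminus\mathbb{R}\to(0,\infty)$ such that the following holds. Let $X>0$, $a>0$, and let $\overline{\omega}_h^{\,0}$ be a non-uniform mesh on $[0,X]$ with nodes $0=x_0^0<x_1^0<\dots<x_{J_0}^0=X$, $J_0\geq2$, and mean step $h_{\omega^0}=X/J_0$. Let $\lambda^0=\lambda_R^0+i\lambda_I^0$ with $\lambda_I^0\neq0$ be an eigenvalue of the problem $$-\widehat{\partial}_x\overline{\partial}_xW=\lambda\, s_NW,\qquad W\in H(\overline{\omega}_h),\qquad W\not\equiv 0,$$ for $\overline{\omega}_h=\overline{\omega}_h^{\,0}$. Let $K\geq1$ be an integer, let $\varkappa>0$, $\tau_0>0$ and $0<\tau\leq\tau_0$, and let $h_\omega=h_{\omega^0}/K$ be the mean step of the mesh $\overline{\omega}_h^{\,0,K}$. If the spectral condition $$|q_\tau(\lambda)|\leq 1+\varkappa\tau,\qquad q_\tau(\lambda)=\frac{1-i\frac{a\lambda\tau}{2}}{1+i\frac{a\lambda\tau}{2}},$$ is valid for the mesh $\overline{\omega}_h=\overline{\omega}_h^{\,0,K}$, i.e. for all eigenvalues $\lambda$ of the problem $-\widehat{\partial}_x\overline{\partial}_xW=\lambda\, s_NW$, $W\in H(\overline{\omega}_h^{\,0,K})$, $W\not\equiv 0$, then $$\frac{1}{\sqrt{\varkappa(2+\varkappa\tau_0)}}\leq c_1\frac{\tau}{h_\omega}+c_2h_\omega,$$ where $c_1=c_1(a\lambda^0h_{\omega^0}^2)$ and $c_2=c_2(a\lambda^0h_{\omega^0}^2)$,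 that is, $c_1>0$ and $c_2>0$ depend solely on $a\lambda^0h_{\omega^0}^2$.
   Context: Meshes and operators. A mesh $\overline{\omega}_h$ on $[0,X]$ has nodes $0=x_0<\dots<x_J=X$ and steps $h_j:=x_j-x_{j-1}$, $1\leq j\leq J$; it is non-uniform if the steps are not all equal; its mean step is $X/J$. Put $\bar h_j:=(h_j+h_{j+1})/2$ for $1\leq j\leq J-1$. $H(\overline{\omega}_h)$ is the space of complex-valued functions $W=(W_0,\dots,W_J)$ on $\overline{\omega}_h$ with $W_0=W_J=0$. For $1\leq j\leq J-1$, $$\widehat{\partial}_x\overline{\partial}_xW_j=\frac{1}{\bar h_j}\left(\frac{W_{j+1}-W_j}{h_{j+1}}-\frac{W_j-W_{j-1}}{h_j}\right),$$ and the Numerov averaging operator is $$s_NW_j=\frac{1}{12}\alpha_jW_{j-1}+\frac56\gamma_jW_j+\frac1{12}\beta_jW_{j+1},$$ $$\alpha_j=2-\frac{h_{j+1}^2}{h_j\bar h_j},\qquad \gamma_j=1+\frac{(h_{j+1}-h_j)^2}{5h_jh_{j+1}},\qquad \beta_j=2-\frac{h_j^2}{h_{j+1}\bar h_j}.$$ An eigenvalue of the problem $-\widehat{\partial}_x\overline{\partial}_xW=\lambda s_NW$ for the mesh $\overline{\omega}_h$ is a number $\lambda\in\mathbb{C}$ for which there is $W\in H(\overline{\omega}_h)$, $W\not\equiv0$, satisfying the equation at all interior nodes $1\leq j\leq J-1$. The meshes $\overline{\omega}_h^{\,0,K}$. Given the mesh $\overline{\omega}_h^{\,0}$ with nodes $0=x_0^0<\dots<x_{J_0}^0=X$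 and an integer $K\geq1$, the mesh $\overline{\omega}_h^{\,0,K}$ on $[0,X]$ has $J=J_0K$ steps and the nodes $$x_{2kJ_0+l}=2k\frac{X}{K}+\frac{x_l^0}{K}\quad\text{for } 0\leq l\leq J_0-1,\ 0\leq 2k<K,$$ $$x_{(2k-1)J_0+l}=2k\frac{X}{K}-\frac{x_{J_0-l}^0}{K}\quad\text{for } 0\leq l\leq J_0-1,\ 1\leq 2k-1<K,$$ with $k$ an integer, and $x_J=X$; its mean step is $h_\omega=X/J=h_{\omega^0}/K$. The constant $a$ is $a=c_\hbar/\hbar=\hbar/(2m_0)>0$, where $\hbar>0$ and $m_0>0$ are the physical constants of the Schrödinger equation $i\hbar\,\partial_t\psi=-\frac{\hbar^2}{2m_0}\partial_x^2\psi+V\psi$; $\tau>0$ is the time step. The spectral condition $|q_\tau(\lambda)|\leq1+\varkappa\tau$ includes the requirement that $q_\tau(\lambda)$ be well defined, i.e. $1+i\frac{a\lambda\tau}{2}\neq0$ (it is regarded as violated if this denominator vanishes). *)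

theory Defs
  imports Complex_Main
begin

text \<open>A mesh with \<open>J\<close> steps is given by its nodes \<open>x 0 < \<dots> < x J\<close>; mesh functions are of type
  \<^typ>\<open>nat \<Rightarrow> complex\<close>. In both cases only the values at the indices \<open>0, \<dots>, J\<close> are relevant.\<close>

definition is_mesh :: "real \<Rightarrow> nat \<Rightarrow> (nat \<Rightarrow> real) \<Rightarrow> bool" where
  "is_mesh X J x \<longleftrightarrow> x 0 = 0 \<and> x J = X \<and> (\<forall>j<J. x j < x (j + 1))"

definition mesh_step :: "(nat \<Rightarrow> real) \<Rightarrow> nat \<Rightarrow> real" where
  "mesh_step x j = x j - x (j - 1)"

definition nonuniform :: "nat \<Rightarrow> (nat \<Rightarrow> real) \<Rightarrow> bool" where
  "nonuniform J x \<longleftrightarrow> (\<exists>i\<in>{1..J}. \<exists>j\<in>{1..J}. mesh_step x i \<noteq> mesh_step x j)"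

definition mean_step :: "real \<Rightarrow> nat \<Rightarrow> real" where
  "mean_step X J = X / real J"

definition half_sum_step :: "(nat \<Rightarrow> real) \<Rightarrow> nat \<Rightarrow> real" where
  "half_sum_step x j = (mesh_step x j + mesh_step x (j + 1)) / 2"

definition mesh_H :: "nat \<Rightarrow> (nat \<Rightarrow> complex) set" where
  "mesh_H J = {W. W 0 = 0 \<and> W J = 0}"

definition second_diff :: "(nat \<Rightarrow> real) \<Rightarrow> (nat \<Rightarrow> complex) \<Rightarrow> nat \<Rightarrow> complex" where
  "second_diff x W j =
     1 / of_real (half_sum_step x j) *
       ((W (j + 1) - W j) / of_real (mesh_step x (j + 1))
        - (W j - W (j - 1)) / of_real (mesh_step x j))"

definition numerov_\<alpha> :: "(nat \<Rightarrow> real) \<Rightarrow> nat \<Rightarrow> real" where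
  "numerov_\<alpha> x j = 2 - (mesh_step x (j + 1))\<^sup>2 / (mesh_step x j * half_sum_step x j)"

definition numerov_\<gamma> :: "(nat \<Rightarrow> real) \<Rightarrow> nat \<Rightarrow> real" where
  "numerov_\<gamma> x j =
     1 + (mesh_step x (j + 1) - mesh_step x j)\<^sup>2 / (5 * mesh_step x j * mesh_step x (j + 1))"

definition numerov_\<beta> :: "(nat \<Rightarrow> real) \<Rightarrow> nat \<Rightarrow> real" where
  "numerov_\<beta> x j = 2 - (mesh_step x j)\<^sup>2 / (mesh_step x (j + 1) * half_sum_step x j)"

definition numerov_avg :: "(nat \<Rightarrow> real) \<Rightarrow> (nat \<Rightarrow> complex) \<Rightarrow> nat \<Rightarrow> complex" where
  "numerov_avg x W j =
     1 / 12 * of_real (numerov_\<alpha> x j) * W (j - 1)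
     + 5 / 6 * of_real (numerov_\<gamma> x j) * W j
     + 1 / 12 * of_real (numerov_\<beta> x j) * W (j + 1)"

definition numerov_eigenvalue :: "nat \<Rightarrow> (nat \<Rightarrow> real) \<Rightarrow> complex \<Rightarrow> bool" where
  "numerov_eigenvalue J x lam \<longleftrightarrow>
     (\<exists>W\<in>mesh_H J. (\<exists>j\<le>J. W j \<noteq> 0) \<and>
        (\<forall>j\<in>{1..<J}. - second_diff x W j = lam * numerov_avg x W j))"

definition q_tau :: "real \<Rightarrow> real \<Rightarrow> complex \<Rightarrow> complex" where
  "q_tau a \<tau> lam =
     (1 - \<i> * (of_real a * lam * of_real \<tau> / 2)) / (1 + \<i> * (of_real a * lam * of_real \<tau> / 2))"

text \<open>Division by zero yields zero in HOL, so that \<^const>\<open>q_tau\<close> being well defined has to be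
  required explicitly.\<close>

definition spectral_condition :: "real \<Rightarrow> real \<Rightarrow> real \<Rightarrow> nat \<Rightarrow> (nat \<Rightarrow> real) \<Rightarrow> bool" where
  "spectral_condition a \<tau> \<kappa> J x \<longleftrightarrow>
     (\<forall>lam. numerov_eigenvalue J x lam \<longrightarrow>
        1 + \<i> * (of_real a * lam * of_real \<tau> / 2) \<noteq> 0 \<and> norm (q_tau a \<tau> lam) \<le> 1 + \<kappa> * \<tau>)"

text \<open>The mesh with \<open>J0 * K\<close> steps on \<open>[0, X]\<close> made of \<open>K\<close> copies of the mesh \<open>x0\<close> scaled by
  \<open>1 / K\<close>, where every second copy is reflected. The node index is written as \<open>n = q * J0 + l\<close>
  with \<open>l < J0\<close>: blocks with even \<open>q = 2 * k\<close> are direct copies, blocks with odd \<open>q = 2 * k - 1\<close>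
  are reflected ones.\<close>

definition refl_mesh :: "real \<Rightarrow> nat \<Rightarrow> (nat \<Rightarrow> real) \<Rightarrow> nat \<Rightarrow> nat \<Rightarrow> real" where
  "refl_mesh X J0 x0 K n =
     (let q = n div J0; l = n mod J0 in
      if n \<ge> J0 * K then X
      else if even q then real q * (X / real K) + x0 l / real K
      else real (q + 1) * (X / real K) - x0 (J0 - l) / real K)"

lemma refl_mesh_even:
  assumes "l < J0" "2 * k < K"
  shows "refl_mesh X J0 x0 K (2 * k * J0 + l) = 2 * real k * (X / real K) + x0 l / real K"
proof -
  have "2 * k * J0 + l < (2 * k + 1) * J0" using assms by simp
  also have "\<dots> \<le> K * J0" using assms by (intro mult_right_mono) auto
  finally have "\<not> 2 * k * J0 + l \<ge> J0 * K" by (simp add: mult.commute)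
  moreover have "(2 * k * J0 + l) div J0 = 2 * k" "(2 * k * J0 + l) mod J0 = l"
    using assms by auto
  ultimately show ?thesis by (simp add: refl_mesh_def Let_def)
qed

lemma refl_mesh_odd:
  assumes "l < J0" "1 \<le> k" "2 * k - 1 < K"
  shows "refl_mesh X J0 x0 K ((2 * k - 1) * J0 + l)
         = 2 * real k * (X / real K) - x0 (J0 - l) / real K"
proof -
  obtain m where k: "k = m + 1" using assms by (metis add.commute le_Suc_ex plus_1_eq_Suc)
  then have m: "2 * k - 1 = 2 * m + 1" by simp
  have "(2 * m + 1) * J0 + l < (2 * m + 2) * J0" using assms by (simp add: algebra_simps)
  also have "\<dots> \<le> K * J0" using assms m by (intro mult_right_mono) auto
  finally have "\<not> (2 * m + 1) * J0 + l \<ge> J0 * K" by (simp add: mult.commute)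
  moreover have "((2 * m + 1) * J0 + l) div J0 = 2 * m + 1" "((2 * m + 1) * J0 + l) mod J0 = l"
    using assms by (simp_all only: div_mult_self3 mod_mult_self3) auto
  moreover have "odd (2 * m + 1)" "real (2 * m + 1 + 1) = 2 * real k" using k by auto
  ultimately show ?thesis unfolding m by (simp only: refl_mesh_def Let_def if_False)
qed

lemma refl_mesh_last: "refl_mesh X J0 x0 K (J0 * K) = X"
  by (simp add: refl_mesh_def Let_def)

lemma is_mesh_refl_mesh:
  assumes x0: "is_mesh X J0 x0" and "0 < J0" "0 < K"
  shows "is_mesh X (J0 * K) (refl_mesh X J0 x0 K)"
proof -
  have node: "refl_mesh X J0 x0 K (q * J0 + l) =
      (if even q then (real q * X + x0 l) / real K else (real (q + 1) * X - x0 (J0 - l)) / real K)"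
    if "q < K" "l \<le> J0" for q l
  proof (cases "l < J0")
    case True
    show ?thesis
    proof (cases "even q")
      case True
      then obtain k where "q = 2 * k" by (elim evenE)
      with refl_mesh_even[of l J0 k K X x0] \<open>l < J0\<close> that show ?thesis
        by (simp add: add_divide_distrib)
    next
      case False
      then obtain k where "q = 2 * k + 1" by (elim oddE)
      with refl_mesh_odd[of l J0 "k + 1" K X x0] \<open>l < J0\<close> that show ?thesis
        by (simp add: diff_divide_distrib add_divide_distrib algebra_simps)
    qed
  next
    case False
    then have l: "l = J0" using that by simp
    show ?thesis
    proof (cases "q + 1 < K")
      case False
      then have q: "K = q + 1" using that by simp
      then have "q * J0 + l = J0 * K" using l by simp
      then have "refl_mesh X J0 x0 K (q * J0 + l) = X" using refl_mesh_last by simp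
      then show ?thesis using x0 q l by (auto simp: is_mesh_def field_simps)
    next
      case True
      have idx: "q * J0 + l = (q + 1) * J0 + 0" using l by simp
      show ?thesis
      proof (cases "even q")
        case True
        then obtain k where "q = 2 * k" by (elim evenE)
        have "(2 * (k + 1) - 1) * J0 + 0 = q * J0 + l" using \<open>q = 2 * k\<close> idx by simp
        then have "refl_mesh X J0 x0 K (q * J0 + l) = 2 * real (k + 1) * (X / real K) - X / real K"
          using refl_mesh_odd[of 0 J0 "k + 1" K X x0] \<open>q = 2 * k\<close> \<open>q + 1 < K\<close> \<open>0 < J0\<close> x0
          by (simp add: is_mesh_def add.commute)
        also have "\<dots> = (real q * X + x0 l) / real K"
          using \<open>q = 2 * k\<close> \<open>0 < K\<close> x0 l by (simp add: is_mesh_def field_simps)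
        finally show ?thesis using \<open>even q\<close> by simp
      next
        case False
        then obtain k where "q = 2 * k + 1" by (elim oddE)
        with refl_mesh_even[of 0 J0 "k + 1" K X x0] \<open>q + 1 < K\<close> \<open>0 < J0\<close> x0 l idx
        show ?thesis
          by (simp add: is_mesh_def diff_divide_distrib add_divide_distrib algebra_simps)
      qed
    qed
  qed
  have "refl_mesh X J0 x0 K 0 = 0"
    using node[of 0 0] x0 assms by (simp add: is_mesh_def)
  moreover have "refl_mesh X J0 x0 K j < refl_mesh X J0 x0 K (j + 1)" if j: "j < J0 * K" for j
  proof -
    define q l where "q = j div J0" and "l = j mod J0"
    have ql: "q < K" "l < J0" "j = q * J0 + l"
      using j assms by (auto simp: q_def l_def less_mult_imp_div_less mult.commute)
    have "x0 l < x0 (l + 1)" using x0 ql by (simp add: is_mesh_def)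
    moreover have "J0 - l = J0 - (l + 1) + 1" using ql by simp
    then have "x0 (J0 - (l + 1)) < x0 (J0 - l)"
      using x0 ql by (metis is_mesh_def diff_less zero_less_Suc add.commute Suc_eq_plus1 assms(2))
    ultimately show ?thesis
      using node[of q l] node[of q "l + 1"] ql assms(3)
      by (auto simp: add.assoc intro!: divide_strict_right_mono)
  qed
  ultimately show ?thesis by (simp add: is_mesh_def refl_mesh_last)
qed

end

theory Submission
  imports Defs
begin

text \<open>The odd reflection of an eigenfunction on the mesh \<open>x0\<close> across the block boundaries is an
  eigenfunction on the mesh made of \<open>K\<close> scaled copies: at a boundary node the two adjacent steps
  coincide and the function is odd, so both sides of the equation vanish there. Hence
  \<open>lam = K\<^sup>2 * lam0\<close> is an eigenvalue of the refined mesh, and \<open>a * lam = z / h\<omega>\<^sup>2\<close> with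
  \<open>z = a * lam0 * h\<omega>0\<^sup>2\<close>. Replacing \<open>lam0\<close> by its conjugate if necessary, we may take
  \<open>Im lam > 0\<close>. With \<open>s = a * \<tau> / 2\<close> the identity
  \<open>\<bar>1 - i s lam\<bar>\<^sup>2 - \<bar>1 + i s lam\<bar>\<^sup>2 = 4 s Im lam\<close> then turns the spectral condition
  into \<open>4 s Im lam \<le> \<kappa> \<tau> (2 + \<kappa> \<tau>) (1 + s\<^sup>2 \<bar>lam\<bar>\<^sup>2)\<close>, and taking the square root
  gives the bound.\<close>

section \<open>The operators under scaling and reflection of the mesh\<close>

lemma second_diff_scaled:
  assumes "mesh_step x j = c * mesh_step y i" "mesh_step x (j + 1) = c * mesh_step y (i + 1)"
    and "W (j - 1) = s * V (i - 1)" "W j = s * V i" "W (j + 1) = s * V (i + 1)"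
  shows "second_diff x W j = s / of_real (c\<^sup>2) * second_diff y V i"
proof -
  have "half_sum_step x j = c * half_sum_step y i"
    using assms by (simp add: half_sum_step_def algebra_simps)
  then show ?thesis
    unfolding second_diff_def assms
    by (simp add: power2_eq_square divide_inverse algebra_simps)
qed

text \<open>The Numerov coefficients are homogeneous of degree 0 in the steps, so the factor
  \<open>c\<close> cancels in them. For \<open>c = 0\<close> the quotients would default to 0
  instead of cancelling.\<close>

lemma numerov_avg_scaled:
  assumes "mesh_step x j = c * mesh_step y i" "mesh_step x (j + 1) = c * mesh_step y (i + 1)"
    and "W (j - 1) = s * V (i - 1)" "W j = s * V i" "W (j + 1) = s * V (i + 1)" and "c \<noteq> 0"
  shows "numerov_avg x W j = s * numerov_avg y V i"
proof -
  have hs: "half_sum_step x j = c * half_sum_step y i"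
    using assms by (simp add: half_sum_step_def algebra_simps)
  have "numerov_\<alpha> x j = numerov_\<alpha> y i" "numerov_\<beta> x j = numerov_\<beta> y i"
    unfolding numerov_\<alpha>_def numerov_\<beta>_def hs assms(1,2)
    using \<open>c \<noteq> 0\<close> by (simp_all add: power2_eq_square mult_ac)
  moreover have "numerov_\<gamma> x j = numerov_\<gamma> y i"
    unfolding numerov_\<gamma>_def assms(1,2) right_diff_distrib[symmetric]
    using \<open>c \<noteq> 0\<close> by (simp add: power2_eq_square mult_ac)
  ultimately show ?thesis
    unfolding numerov_avg_def assms by (simp add: algebra_simps)
qed

text \<open>Reflection exchanges the two difference quotients and flips the sign of each, so their
  difference is preserved.\<close>

lemma second_diff_reflected:
  assumes "mesh_step x j = mesh_step y (i + 1)" "mesh_step x (j + 1) = mesh_step y i"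
    and "W (j - 1) = V (i + 1)" "W j = V i" "W (j + 1) = V (i - 1)"
  shows "second_diff x W j = second_diff y V i"
proof -
  have "half_sum_step x j = half_sum_step y i"
    using assms by (simp add: half_sum_step_def)
  then show ?thesis
    unfolding second_diff_def assms
    by (simp add: divide_inverse algebra_simps)
qed

text \<open>Exchanging the two steps swaps \<alpha> with \<beta> and fixes \<gamma>, which is
  symmetric in the steps; the neighbouring values are swapped as well.\<close>

lemma numerov_avg_reflected:
  assumes "mesh_step x j = mesh_step y (i + 1)" "mesh_step x (j + 1) = mesh_step y i"
    and "W (j - 1) = V (i + 1)" "W j = V i" "W (j + 1) = V (i - 1)"
  shows "numerov_avg x W j = numerov_avg y V i"
proof -
  have "half_sum_step x j = half_sum_step y i"
    using assms by (simp add: half_sum_step_def)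
  then have "numerov_\<alpha> x j = numerov_\<beta> y i" "numerov_\<beta> x j = numerov_\<alpha> y i"
    "numerov_\<gamma> x j = numerov_\<gamma> y i"
    unfolding numerov_\<alpha>_def numerov_\<beta>_def numerov_\<gamma>_def assms(1,2)
    by (simp_all add: mult_ac power2_commute)
  then show ?thesis
    unfolding numerov_avg_def assms by (simp add: algebra_simps)
qed

section \<open>Block structure of the refined mesh and of the odd reflection\<close>

definition rev_mesh :: "nat \<Rightarrow> (nat \<Rightarrow> real) \<Rightarrow> nat \<Rightarrow> real" where
  "rev_mesh J x j = x J - x (J - j)"

lemma numerov_equation_rev_mesh:
  assumes "- second_diff x W (J - l) = lam * numerov_avg x W (J - l)" "0 < l" "l < J"
  shows "- second_diff (rev_mesh J x) (\<lambda>j. W (J - j)) l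
         = lam * numerov_avg (rev_mesh J x) (\<lambda>j. W (J - j)) l"
proof -
  have idx: "J - (l - 1) = J - l + 1" "J - (l + 1) = J - l - 1"
    using assms by auto
  have steps: "mesh_step (rev_mesh J x) l = mesh_step x (J - l + 1)"
    "mesh_step (rev_mesh J x) (l + 1) = mesh_step x (J - l)"
    using idx by (simp_all add: mesh_step_def rev_mesh_def)
  note args = steps idx[THEN arg_cong[where f = W]]
  show ?thesis
    using assms(1) args
      second_diff_reflected[OF steps, of "\<lambda>j. W (J - j)" W]
      numerov_avg_reflected[OF steps, of "\<lambda>j. W (J - j)" W]
    by simp
qed

text \<open>For \<open>W\<close> vanishing at both ends this is the extension that is odd about
  every block boundary.\<close>

definition odd_refl :: "nat \<Rightarrow> (nat \<Rightarrow> complex) \<Rightarrow> nat \<Rightarrow> complex" where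
  "odd_refl J W n =
     (if even (n div J) then W (n mod J) else - W (J - n mod J))"

text \<open>The case \<open>l = J\<close> is included because stencils reach the right end of a
  block. That index belongs to the next block in \<open>odd_refl\<close>, but both readings give 0
  since \<open>W\<close> vanishes at 0 and \<open>J\<close>.\<close>

lemma odd_refl_block:
  assumes "W \<in> mesh_H J" "l \<le> J" "0 < J"
  shows "odd_refl J W (q * J + l) = (if even q then W l else - W (J - l))"
proof (cases "l = J")
  case True
  then have "(q * J + l) div J = q + 1" "(q * J + l) mod J = 0"
    using assms by simp_all
  then show ?thesis using assms True by (simp add: odd_refl_def mesh_H_def)
next
  case False
  then show ?thesis using assms by (simp add: odd_refl_def)
qed

text \<open>As \<open>x0 J = X\<close>, an odd block can also be measured from its left end
  \<open>q * X / K\<close>, which makes it a shifted copy of \<open>rev_mesh J x0\<close> scaled by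
  \<open>1 / K\<close>. Both parities thus get the same form.\<close>

lemma refl_mesh_block:
  assumes x0: "is_mesh X J x0" and "q < K" "l \<le> J" "0 < J"
  shows "refl_mesh X J x0 K (q * J + l)
         = real q * (X / real K) + (if even q then x0 else rev_mesh J x0) l / real K"
proof -
  have inner: "refl_mesh X J x0 K (q * J + l)
         = real q * (X / real K) + (if even q then x0 else rev_mesh J x0) l / real K"
    if "q < K" "l < J" for q l
  proof -
    have "q * J + l < (q + 1) * J" using that by simp
    also have "\<dots> \<le> J * K" using that by (subst mult.commute) (intro mult_left_mono, auto)
    finally have "\<not> q * J + l \<ge> J * K" by simp
    moreover have "(q * J + l) div J = q" "(q * J + l) mod J = l" using that by simp_all
    ultimately show ?thesis
      using x0 by (simp add: refl_mesh_def rev_mesh_def is_mesh_def diff_divide_distrib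
          add_divide_distrib algebra_simps)
  qed
  show ?thesis
  proof (cases "l < J")
    case True
    then show ?thesis using inner assms by blast
  next
    case False
    then have l: "l = J" using assms by simp
    then have "q * J + l = (q + 1) * J" by simp
    \<comment> \<open>The right end of block \<open>q\<close> is node 0 of the next block or, for
      the last block, the final node \<open>X\<close>.\<close>
    moreover have "refl_mesh X J x0 K ((q + 1) * J) = real (q + 1) * (X / real K)"
    proof (cases "q + 1 < K")
      case True
      then show ?thesis
        using inner[of "q + 1" 0] x0 \<open>0 < J\<close> by (simp add: rev_mesh_def is_mesh_def)
    next
      case False
      then have "K = q + 1" using assms by simp
      then show ?thesis using refl_mesh_last[of X J x0 K] by (simp add: mult.commute)
    qed
    ultimately show ?thesis
      using x0 l by (simp add: rev_mesh_def is_mesh_def add_divide_distrib algebra_simps)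
  qed
qed

lemma mesh_step_refl_mesh:
  assumes x0: "is_mesh X J x0" and "q < K" "0 < l" "l \<le> J" "0 < J"
  shows "mesh_step (refl_mesh X J x0 K) (q * J + l)
         = 1 / real K * mesh_step (if even q then x0 else rev_mesh J x0) l"
proof -
  have "q * J + l - 1 = q * J + (l - 1)" using assms by simp
  then show ?thesis
    using assms refl_mesh_block[OF x0 \<open>q < K\<close>, of l] refl_mesh_block[OF x0 \<open>q < K\<close>, of "l - 1"]
    by (simp add: mesh_step_def diff_divide_distrib)
qed

text \<open>Equal steps give \<alpha> = \<beta>, so opposite neighbours cancel in the average as
  well as in the second difference, whatever \<open>lam\<close> is.\<close>

lemma numerov_equation_odd_junction:
  assumes "mesh_step x (j + 1) = mesh_step x j" "W j = 0" "W (j + 1) = - W (j - 1)"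
  shows "- second_diff x W j = lam * numerov_avg x W j"
  using assms by (simp add: second_diff_def numerov_avg_def numerov_\<alpha>_def numerov_\<beta>_def)

section \<open>Eigenvalues of the refined mesh and conjugate eigenvalues\<close>

lemma numerov_eigenvalue_refl_mesh:
  assumes x0: "is_mesh X J x0" and J: "0 < J" and K: "0 < K"
    and eig: "numerov_eigenvalue J x0 lam"
  shows "numerov_eigenvalue (J * K) (refl_mesh X J x0 K) (of_nat (K\<^sup>2) * lam)"
proof -
  obtain W where W: "W \<in> mesh_H J" and nz: "\<exists>j\<le>J. W j \<noteq> 0"
    and eq: "\<And>j. j \<in> {1..<J} \<Longrightarrow> - second_diff x0 W j = lam * numerov_avg x0 W j"
    using eig unfolding numerov_eigenvalue_def by blast
  define x where "x = refl_mesh X J x0 K"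
  define V where "V = odd_refl J W"
  note V = odd_refl_block[OF W _ J, folded V_def]
  note step = mesh_step_refl_mesh[OF x0 _ _ _ J, of _ K, folded x_def]
  have "V 0 = 0" using V[of 0 0] W by (simp add: mesh_H_def)
  moreover have "V (J * K) = 0" using V[of 0 K] W by (simp add: mesh_H_def mult.commute)
  ultimately have "V \<in> mesh_H (J * K)" by (simp add: mesh_H_def)
  moreover have "\<exists>j\<le>J * K. V j \<noteq> 0"
  proof -
    obtain j where "j \<le> J" "W j \<noteq> 0" using nz by blast
    moreover have "j \<le> J * K" using \<open>j \<le> J\<close> K by (metis mult_le_mono2 mult.right_neutral
          Suc_leI One_nat_def le_trans)
    ultimately show ?thesis using V[of j 0] by auto
  qed
  moreover have "- second_diff x V n = of_nat (K\<^sup>2) * lam * numerov_avg x V n"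
    if n: "n \<in> {1..<J * K}" for n
  proof -
    define q l where "q = n div J" and "l = n mod J"
    have ql: "q < K" "l < J" "n = q * J + l"
      using n J by (auto simp: q_def l_def less_mult_imp_div_less mult.commute)
    show ?thesis
    proof (cases "l = 0")
      case True
      \<comment> \<open>Since \<open>n > 0\<close>, a block boundary has a preceding block
        \<open>p\<close>. The parities of \<open>p\<close> and \<open>q\<close> differ, so the last
        step of \<open>p\<close> and the first step of \<open>q\<close> are scalings of the same
        step of \<open>x0\<close>.\<close>
      with ql n obtain p where p: "q = Suc p" by (cases q) auto
      have n1: "n = p * J + J" "n - 1 = p * J + (J - 1)" using ql p True J by auto
      have "mesh_step x (n + 1) = mesh_step x n"
        using step[of q 1] step[of p J] ql p n1 True J
        by (auto simp: rev_mesh_def mesh_step_def add_ac)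
      moreover have "V n = 0" using V[of 0 q] ql True W by (simp add: mesh_H_def)
      moreover have "V (n + 1) = - V (n - 1)"
        using V[of 1 q] V[of "J - 1" p] ql p n1 True J by (auto simp: Suc_leI add_ac)
      ultimately show ?thesis by (rule numerov_equation_odd_junction)
    next
      case False
      \<comment> \<open>Inside block \<open>q\<close> the mesh is a scaled copy of \<open>y\<close>
        and \<open>V\<close> is \<open>s\<close> times \<open>U\<close>; the equation for
        \<open>U\<close> on \<open>y\<close> is the original one, possibly reflected.\<close>
      define y where "y = (if even q then x0 else rev_mesh J x0)"
      define U where "U = (\<lambda>j. if even q then W j else W (J - j))"
      define s :: complex where "s = (if even q then 1 else - 1)"
      have base: "- second_diff y U l = lam * numerov_avg y U l"
        using eq[of l] numerov_equation_rev_mesh[OF eq[of "J - l"]] False ql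
        by (auto simp: y_def U_def)
      have "V (q * J + j) = s * U j" if "j \<le> J" for j
        using V[OF that, of q] by (simp add: s_def U_def)
      from this[of "l - 1"] this[of l] this[of "l + 1"]
      have vals: "V (n - 1) = s * U (l - 1)" "V n = s * U l" "V (n + 1) = s * U (l + 1)"
        using False ql by (simp_all add: add.assoc)
      have steps: "mesh_step x n = 1 / real K * mesh_step y l"
        "mesh_step x (n + 1) = 1 / real K * mesh_step y (l + 1)"
        using step[of q l] step[of q "l + 1"] False ql by (simp_all add: y_def add.assoc)
      \<comment> \<open>Scaling the steps by \<open>1 / K\<close> multiplies the second difference
        by \<open>K\<^sup>2\<close> and leaves the average alone, whence the factor in the
        eigenvalue.\<close>
      have "- second_diff x V n = s * of_nat (K\<^sup>2) * (- second_diff y U l)"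
        using second_diff_scaled[OF steps vals] K by (simp add: power_divide)
      also have "\<dots> = of_nat (K\<^sup>2) * lam * (s * numerov_avg y U l)"
        unfolding base by (simp add: mult_ac)
      also have "s * numerov_avg y U l = numerov_avg x V n"
        using numerov_avg_scaled[OF steps vals] K by simp
      finally show ?thesis .
    qed
  qed
  ultimately show ?thesis unfolding numerov_eigenvalue_def x_def by blast
qed

text \<open>Steps and coefficients are real, so both operators commute with conjugation.\<close>

lemma numerov_eigenvalue_cnj:
  assumes "numerov_eigenvalue J x lam"
  shows "numerov_eigenvalue J x (cnj lam)"
proof -
  obtain W where W: "W \<in> mesh_H J" "\<exists>j\<le>J. W j \<noteq> 0"
    and eq: "\<And>j. j \<in> {1..<J} \<Longrightarrow> - second_diff x W j = lam * numerov_avg x W j"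
    using assms unfolding numerov_eigenvalue_def by blast
  have "second_diff x (cnj \<circ> W) j = cnj (second_diff x W j)"
    "numerov_avg x (cnj \<circ> W) j = cnj (numerov_avg x W j)" for j
    by (simp_all add: second_diff_def numerov_avg_def)
  then have "- second_diff x (cnj \<circ> W) j = cnj lam * numerov_avg x (cnj \<circ> W) j"
    if "j \<in> {1..<J}" for j
    using eq[OF that] by (metis complex_cnj_minus complex_cnj_mult)
  moreover have "cnj \<circ> W \<in> mesh_H J" "\<exists>j\<le>J. (cnj \<circ> W) j \<noteq> 0"
    using W by (auto simp: mesh_H_def)
  ultimately show ?thesis unfolding numerov_eigenvalue_def by blast
qed

section \<open>From the spectral condition to the bound\<close>

lemma Im_le_of_norm_q_tau_le:
  assumes q: "norm (q_tau a \<tau> lam) \<le> 1 + \<kappa> * \<tau>"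
    and den: "1 + \<i> * (of_real a * lam * of_real \<tau> / 2) \<noteq> 0"
    and pos: "0 < a" "0 < \<tau>" "\<tau> \<le> \<tau>0" "0 < \<kappa>" "0 < Im lam"
  shows "2 * a * Im lam \<le> \<kappa> * (2 + \<kappa> * \<tau>0) * (1 + (a * \<tau> / 2)\<^sup>2 * (norm lam)\<^sup>2)"
proof -
  define s where "s = a * \<tau> / 2"
  define D where "D = (norm (1 + \<i> * (of_real s * lam)))\<^sup>2"
  have s: "0 < s" using pos by (simp add: s_def)
  have [simp]: "of_real a * lam * of_real \<tau> / 2 = of_real s * lam"
    by (simp add: s_def)
  have D: "D = 1 - 2 * s * Im lam + s\<^sup>2 * (norm lam)\<^sup>2"
    unfolding D_def cmod_power2 by (simp add: power2_eq_square algebra_simps)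
  have N: "(norm (1 - \<i> * (of_real s * lam)))\<^sup>2 = D + 4 * s * Im lam"
    unfolding D cmod_power2 by (simp add: power2_eq_square algebra_simps)
  have "norm (1 - \<i> * (of_real s * lam)) \<le> (1 + \<kappa> * \<tau>) * norm (1 + \<i> * (of_real s * lam))"
    using q den by (simp add: q_tau_def norm_divide divide_le_eq)
  from power_mono[OF this norm_ge_zero, of 2]
  have "D + 4 * s * Im lam \<le> (1 + \<kappa> * \<tau>)\<^sup>2 * D"
    unfolding power_mult_distrib N D_def[symmetric] .
  \<comment> \<open>Here \<open>4 * s = 2 * a * \<tau>\<close> and \<open>(1 + \<kappa> *
    \<tau>)\<^sup>2 - 1 = \<kappa> * \<tau> * (2 + \<kappa> * \<tau>)\<close>, so a factor
    \<open>\<tau>\<close> can be cancelled.\<close>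
  then have "\<tau> * (2 * a * Im lam) \<le> \<tau> * (\<kappa> * (2 + \<kappa> * \<tau>) * D)"
    by (simp add: s_def power2_eq_square algebra_simps)
  then have "2 * a * Im lam \<le> \<kappa> * (2 + \<kappa> * \<tau>) * D"
    using pos by simp
  also have "\<dots> \<le> \<kappa> * (2 + \<kappa> * \<tau>0) * (1 + s\<^sup>2 * (norm lam)\<^sup>2)"
  proof (intro mult_mono)
    \<comment> \<open>The dropped term \<open>- 2 * s * Im lam\<close> is negative.\<close>
    show "D \<le> 1 + s\<^sup>2 * (norm lam)\<^sup>2" using pos s by (simp add: D)
    show "0 \<le> D" by (simp add: D_def)
  qed (use pos in auto)
  finally show ?thesis by (simp add: s_def)
qed

theorem proposition2:
  "\<exists>c1 c2 :: complex \<Rightarrow> real.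
     (\<forall>z. z \<notin> \<real> \<longrightarrow> c1 z > 0 \<and> c2 z > 0) \<and>
     (\<forall>(X :: real) (a :: real) (J0 :: nat) (x0 :: nat \<Rightarrow> real) (lam0 :: complex)
        (K :: nat) (\<kappa> :: real) (\<tau>0 :: real) (\<tau> :: real) (h\<omega>0 :: real) (h\<omega> :: real).
        X > 0 \<longrightarrow> a > 0 \<longrightarrow> J0 \<ge> 2 \<longrightarrow>
        is_mesh X J0 x0 \<longrightarrow> nonuniform J0 x0 \<longrightarrow> h\<omega>0 = mean_step X J0 \<longrightarrow>
        numerov_eigenvalue J0 x0 lam0 \<longrightarrow> Im lam0 \<noteq> 0 \<longrightarrow>
        K \<ge> 1 \<longrightarrow> \<kappa> > 0 \<longrightarrow> \<tau>0 > 0 \<longrightarrow> 0 < \<tau> \<longrightarrow> \<tau> \<le> \<tau>0 \<longrightarrow>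
        h\<omega> = mean_step X (J0 * K) \<longrightarrow>
        spectral_condition a \<tau> \<kappa> (J0 * K) (refl_mesh X J0 x0 K) \<longrightarrow>
        1 / sqrt (\<kappa> * (2 + \<kappa> * \<tau>0))
          \<le> c1 (of_real a * lam0 * of_real (h\<omega>0\<^sup>2)) * (\<tau> / h\<omega>)
            + c2 (of_real a * lam0 * of_real (h\<omega>0\<^sup>2)) * h\<omega>)"
proof -
  \<comment> \<open>These are the square roots of the coefficients of
    \<open>(\<tau> / h)\<^sup>2\<close> and \<open>h\<^sup>2\<close> in the upper bound for
    \<open>1 / B\<close> derived below.\<close>
  define c1 c2 :: "complex \<Rightarrow> real"
    where "c1 z = norm z / sqrt (8 * \<bar>Im z\<bar>)" and "c2 z = 1 / sqrt (2 * \<bar>Im z\<bar>)" for z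
  have "c1 z > 0 \<and> c2 z > 0" if "z \<notin> \<real>" for z
  proof -
    from that have "Im z \<noteq> 0" by (simp add: complex_is_Real_iff)
    moreover from this have "z \<noteq> 0" by auto
    ultimately show ?thesis by (simp add: c1_def c2_def)
  qed
  moreover have "1 / sqrt (\<kappa> * (2 + \<kappa> * \<tau>0))
      \<le> c1 (of_real a * lam0 * of_real (h0\<^sup>2)) * (\<tau> / h)
        + c2 (of_real a * lam0 * of_real (h0\<^sup>2)) * h"
    if X: "X > 0" and a: "a > 0" and J0: "J0 \<ge> 2" and x0: "is_mesh X J0 x0"
      and h0: "h0 = mean_step X J0" and eig: "numerov_eigenvalue J0 x0 lam0"
      and Im0: "Im lam0 \<noteq> 0" and K: "K \<ge> 1" and \<kappa>: "\<kappa> > 0" and \<tau>: "0 < \<tau>" "\<tau> \<le> \<tau>0"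
      and h: "h = mean_step X (J0 * K)"
      and spec: "spectral_condition a \<tau> \<kappa> (J0 * K) (refl_mesh X J0 x0 K)"
    for X a \<kappa> \<tau>0 \<tau> h0 h :: real and J0 K :: nat and x0 :: "nat \<Rightarrow> real" and lam0 :: complex
  proof -
    \<comment> \<open>An eigenvalue in the lower half-plane gives
      \<open>norm (q_tau a \<tau> lam) < 1\<close> and hence no information, so the one in the upper
      half-plane is chosen.\<close>
    define mu where "mu = (if Im lam0 > 0 then lam0 else cnj lam0)"
    define z where "z = of_real a * lam0 * of_real (h0\<^sup>2)"
    define lam where "lam = of_nat (K\<^sup>2) * mu"
    define B where "B = \<kappa> * (2 + \<kappa> * \<tau>0)"
    define M where "M = \<bar>Im z\<bar>"
    have hpos: "h > 0" "h0 > 0" "h0 = K * h"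
      using X J0 K by (simp_all add: h h0 mean_step_def)
    have B: "B > 0" using \<kappa> \<tau> by (simp add: B_def add_pos_pos)
    have M: "M > 0" using Im0 a hpos K by (simp add: M_def z_def)
    have "numerov_eigenvalue J0 x0 mu"
      using eig numerov_eigenvalue_cnj by (simp add: mu_def)
    then have "numerov_eigenvalue (J0 * K) (refl_mesh X J0 x0 K) lam"
      using numerov_eigenvalue_refl_mesh[OF x0] J0 K by (simp add: lam_def)
    then have sc: "1 + \<i> * (of_real a * lam * of_real \<tau> / 2) \<noteq> 0"
      "norm (q_tau a \<tau> lam) \<le> 1 + \<kappa> * \<tau>"
      using spec by (auto simp: spectral_condition_def)
    have Im_mu: "Im mu = \<bar>Im lam0\<bar>" using Im0 by (simp add: mu_def)
    have norm_mu: "norm mu = norm lam0" by (simp add: mu_def)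
    \<comment> \<open>Since \<open>h0 = K * h\<close>, the factor \<open>K\<^sup>2\<close> turns
      \<open>h0\<^sup>2\<close> into \<open>h\<^sup>2\<close>. Passing from \<open>lam0\<close> to
      \<open>mu\<close> preserves the norm and the absolute value of the imaginary part, so
      \<open>z\<close> can be formed with \<open>lam0\<close>.\<close>
    have Im_lam: "a * Im lam = M / h\<^sup>2"
      using hpos a Im_mu by (simp add: lam_def M_def z_def abs_mult power_mult_distrib)
    have norm_lam: "a * norm lam = norm z / h\<^sup>2"
      using hpos a norm_mu by (simp add: lam_def z_def norm_mult norm_power power_mult_distrib)
    have "Im lam > 0" using Im_mu Im0 K by (simp add: lam_def)
    from Im_le_of_norm_q_tau_le[OF sc(2,1) a \<tau> \<kappa> this]
    have "2 * (a * Im lam) \<le> B * (1 + (\<tau> / 2 * (a * norm lam))\<^sup>2)"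
      by (simp add: B_def power_mult_distrib power_divide mult_ac)
    then have main: "2 * (M / h\<^sup>2) \<le> B * (1 + (\<tau> / 2 * (norm z / h\<^sup>2))\<^sup>2)"
      unfolding Im_lam norm_lam .
    have "1 / B \<le> (1 + (\<tau> / 2 * (norm z / h\<^sup>2))\<^sup>2) / (2 * (M / h\<^sup>2))"
      using main B M hpos by (simp add: divide_simps mult_ac)
    also have "\<dots> = (norm z * (\<tau> / h))\<^sup>2 / (8 * M) + h\<^sup>2 / (2 * M)"
      using M hpos by (simp add: field_simps power2_eq_square)
    also have "\<dots> = (c1 z * (\<tau> / h))\<^sup>2 + (c2 z * h)\<^sup>2"
      using M by (simp add: c1_def c2_def M_def[symmetric] power_mult_distrib power_divide)
    finally have "sqrt (1 / B) \<le> sqrt ((c1 z * (\<tau> / h))\<^sup>2 + (c2 z * h)\<^sup>2)"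
      by (rule real_sqrt_le_mono)
    also have "\<dots> \<le> c1 z * (\<tau> / h) + c2 z * h"
      using hpos \<tau> by (intro sqrt_sum_squares_le_sum) (simp_all add: c1_def c2_def)
    finally show ?thesis
      by (simp add: real_sqrt_divide B_def z_def)
  qed
  ultimately show ?thesis by blast
qed

end
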